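(* Let $k\ge2$ and $t\ge1$ be integers with $\gcd(k-1,tk+1)=1$, let $n=(k-1)(tk+1)$, $l=t(k-1)+1$, and identify $\mathbb{Z}_n$ with $\mathbb{Z}_{k-1}\times\mathbb{Z}_{tk+1}$. Assume $t(k-1)+k-2\ge 2$. Let $\mathcal{R}=\{R_1,\dots,R_l\}$ be an $(n,(k,\dots,k,k-1),k-1)$-PDF over $\mathbb{Z}_n$ with $|R_i|=k$ for $1\le i\le l-1$ and $R_l=\mathbb{Z}_{k-1}\times\{0\}$. Let $\mathcal{V}=\{V_1,\dots,V_{t(k-1)+k-2}\}$ be the family of disjoint subsets of $\mathbb{Z}_n$ defined by $V_i=R_i$ for $1\le i\le t(k-1)$ and $V_{t(k-1)+j}=\{(j,0)\}$ for $1\le j\le k-2$. Then $\mathcal{V}$ is a cyclic $$\bigl(n,\ t(k-1)+k-2,\ K=(k,\dots,k,1,\dots,1),\ n-1,\ (t+1)k^2-(t+3)k\bigr)\text{-SWEDF},$$ where the element $1$ appears $k-2$ times and the element $k$ appears $t(k-1)$ times in $K$.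
   Context: PDF: a family $\{B_1,\dots,B_m\}$ of subsets of an Abelian group $G$ of order $n$ that partitions $G$, with $K=(|B_1|,\dots,|B_m|)$, is an $(n,K,\lambda)$-partitioned difference family (PDF) if each nonzero element of $G$ appears exactly $\lambda$ times in the multi-set union of the multi-sets $\{x-y: x,y\in B_i,\ x\ne y\}$, $1\le i\le m$. SWEDF: for multi-sets $B_1,B_2$ of elements of an Abelian group $G$ of order $n$, $D(B_1,B_2)$ is the multi-set $\{x-y : x\in B_1,\ y\in B_2\}$; $k\boxtimes B$ is the multi-set in which each element of $B$ is repeated $k$ times; unions are multi-set unions. Let $\mathcal{B}=\{B_i : 1\le i\le m\}$ be a family of pairwise disjoint nonempty subsets of $G$, $k_i=|B_i|$, $K=(k_1,\dots,k_m)$, $a=\sum_i k_i$, $\widetilde{k}=\mathrm{lcm}(k_1,\dots,k_m)$, $\widetilde{B}_i=\frac{\widetilde{k}}{k_i}\boxtimes B_i$. Then $\mathcal{B}$ is an $(n,m,K,a,\lambda)$-SWEDF (standard weighted external difference family), where $\lambda$ is a positive integer, if $\bigcup_{1\le i\ne j\le m}D(B_i,\widetilde{B}_j)=\lambda\boxtimes(G\setminus\{0\})$. A cyclic SWEDF is an SWEDF over a cyclic additive group. *)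

theory Defs
  imports
    "HOL-Algebra.Elementary_Groups"
    "HOL-Library.Multiset"
    "HOL-Library.Disjoint_Sets"
    "HOL-Number_Theory.Cong"
begin

text \<open>
  Abelian groups are the commutative groups of HOL-Algebra, whose operation is written
  multiplicatively: the difference \<open>x - y\<close> appears as \<open>x \<otimes> inv y\<close> and \<open>0\<close> as \<open>\<one>\<close>.
  A family \<open>B\<^sub>1, \<dots>, B\<^sub>m\<close> is a function on \<open>nat\<close> considered on \<open>{1..m}\<close> only, and a tuple
  \<open>K\<close> of block sizes is a list.
\<close>

definition block_sizes :: "nat \<Rightarrow> (nat \<Rightarrow> 'a set) \<Rightarrow> nat list" where
  "block_sizes m B = map (\<lambda>i. card (B i)) [1..<Suc m]"

definition PDF :: "('a, 'b) monoid_scheme \<Rightarrow> nat \<Rightarrow> nat \<Rightarrow> nat list \<Rightarrow> nat \<Rightarrow> (nat \<Rightarrow> 'a set) \<Rightarrow> bool" where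
  "PDF G n m K lam B \<longleftrightarrow>
     comm_group G \<and> finite (carrier G) \<and> order G = n \<and>
     partition_on (carrier G) (B ` {1..m}) \<and> disjoint_family_on B {1..m} \<and>
     block_sizes m B = K \<and>
     (\<forall>d \<in> carrier G - {\<one>\<^bsub>G\<^esub>}.
        count (\<Sum>i = 1..m. image_mset (\<lambda>(x, y). x \<otimes>\<^bsub>G\<^esub> inv\<^bsub>G\<^esub> y)
                 (mset_set {(x, y). x \<in> B i \<and> y \<in> B i \<and> x \<noteq> y})) d = lam)"

definition diff_mset :: "('a, 'b) monoid_scheme \<Rightarrow> 'a multiset \<Rightarrow> 'a multiset \<Rightarrow> 'a multiset" where
  "diff_mset G A B = (\<Sum>x \<in># A. image_mset (\<lambda>y. x \<otimes>\<^bsub>G\<^esub> inv\<^bsub>G\<^esub> y) B)"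

definition weighted_block :: "nat \<Rightarrow> (nat \<Rightarrow> 'a set) \<Rightarrow> nat \<Rightarrow> 'a multiset" where
  "weighted_block m B i =
     repeat_mset (Lcm ((\<lambda>j. card (B j)) ` {1..m}) div card (B i)) (mset_set (B i))"

definition SWEDF ::
  "('a, 'b) monoid_scheme \<Rightarrow> nat \<Rightarrow> nat \<Rightarrow> nat list \<Rightarrow> nat \<Rightarrow> nat \<Rightarrow> (nat \<Rightarrow> 'a set) \<Rightarrow> bool" where
  "SWEDF G n m K a lam B \<longleftrightarrow>
     comm_group G \<and> finite (carrier G) \<and> order G = n \<and>
     (\<forall>i \<in> {1..m}. B i \<noteq> {} \<and> B i \<subseteq> carrier G) \<and> disjoint_family_on B {1..m} \<and>
     block_sizes m B = K \<and> sum_list K = a \<and> 0 < lam \<and>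
     (\<Sum>(i, j) \<in> {(i, j). i \<in> {1..m} \<and> j \<in> {1..m} \<and> i \<noteq> j}.
        diff_mset G (mset_set (B i)) (weighted_block m B j))
       = repeat_mset lam (mset_set (carrier G - {\<one>\<^bsub>G\<^esub>}))"

definition cyclic_SWEDF ::
  "('a, 'b) monoid_scheme \<Rightarrow> nat \<Rightarrow> nat \<Rightarrow> nat list \<Rightarrow> nat \<Rightarrow> nat \<Rightarrow> (nat \<Rightarrow> 'a set) \<Rightarrow> bool" where
  "cyclic_SWEDF G n m K a lam B \<longleftrightarrow> cyclic_group G \<and> SWEDF G n m K a lam B"

text \<open>
  For coprime \<open>p\<close> and \<open>q\<close>, the residue map is one of the isomorphisms that identify the integers
  modulo \<open>p * q\<close> with the product of the integers modulo \<open>p\<close> and modulo \<open>q\<close>.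
\<close>

lemma residue_map_iso:
  fixes p q :: nat
  assumes "coprime p q" and "0 < p" and "0 < q"
  shows "(\<lambda>x. (x mod int p, x mod int q))
           \<in> iso (integer_mod_group (p * q)) (integer_mod_group p \<times>\<times> integer_mod_group q)"
    (is "?f \<in> iso ?G ?H")
proof -
  have cop: "coprime (int p) (int q)"
    using assms(1) by simp
  have hom: "?f \<in> hom ?G ?H"
    using assms(2,3)
    by (auto simp: hom_def carrier_integer_mod_group mod_mod_cancel mod_add_eq)
  have inj: "inj_on ?f (carrier ?G)"
  proof (rule inj_onI)
    fix x y
    assume x: "x \<in> carrier ?G" and y: "y \<in> carrier ?G" and eq: "?f x = ?f y"
    then have "[x = y] (mod int p)" "[x = y] (mod int q)"
      by (auto simp: cong_def)
    then have "[x = y] (mod int p * int q)"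
      using cop coprime_cong_mult by blast
    then show "x = y"
      using x y assms(2,3) by (simp add: carrier_integer_mod_group cong_def)
  qed
  have "card (?f ` carrier ?G) = card (carrier ?H)"
    using assms(2,3) inj
    by (simp add: card_image carrier_integer_mod_group card_cartesian_product nat_mult_distrib)
  moreover have "?f ` carrier ?G \<subseteq> carrier ?H"
    using hom by (auto simp: hom_def)
  moreover have "finite (carrier ?H)"
    using assms(2,3) by (simp add: carrier_integer_mod_group)
  ultimately have "?f ` carrier ?G = carrier ?H"
    by (simp add: card_subset_eq)
  with hom inj show ?thesis
    by (simp add: iso_def bij_betw_def)
qed

end

theory Submission
  imports Defs
begin

text \<open>
  The blocks \<open>V j\<close> partition the non-identity elements, so for fixed \<open>d \<noteq> \<one>\<close> the external
  differences equal to \<open>d\<close>, weighted by \<open>w j = k / |V j|\<close>, number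
  \<open>\<Sum>j. w j * (|V j| - [inv d \<in> V j] - I j)\<close>, where \<open>I j\<close> counts the internal differences of
  \<open>V j\<close> equal to \<open>d\<close>. With \<open>m\<close> blocks the first term contributes \<open>k * m\<close>. Let \<open>H\<close> be the
  subgroup \<open>R l\<close>. Of the \<open>k - 1\<close> internal differences of the PDF equal to \<open>d\<close>, those of \<open>H\<close> are
  all if \<open>d \<in> H\<close> and none otherwise, and singletons have no internal differences; hence
  the other two terms contribute \<open>k + 0\<close> if \<open>d \<in> H\<close> and \<open>1 + (k - 1)\<close> otherwise. The count is \<open>k * (m - 1)\<close> in both cases.
\<close>

section \<open>Multiplicities of a fixed group element among differences\<close>

definition diff_count :: "('a, 'b) monoid_scheme \<Rightarrow> 'a \<Rightarrow> 'a set \<Rightarrow> 'a set \<Rightarrow> nat" where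
  "diff_count G d X Y = (\<Sum>y\<in>Y. of_bool (d \<otimes>\<^bsub>G\<^esub> y \<in> X))"

lemma in_repeat_msetD: "x \<in># repeat_mset w M \<Longrightarrow> x \<in># M"
  by (induction w) auto

lemma count_image_repeat_mset:
  "count (image_mset f (repeat_mset w M)) d = w * count (image_mset f M) d"
  by (induction w) auto

lemma count_image_mset_set:
  assumes "finite Y"
  shows "count (image_mset f (mset_set Y)) d = (\<Sum>y\<in>Y. of_bool (f y = d))"
  using assms by (induction Y) auto

text \<open>In a group \<open>x \<otimes> inv y = d\<close> forces \<open>x = d \<otimes> y\<close>,
  so each \<open>y\<close> contributes at most one \<open>x\<close>. This is why
  \<open>diff_count\<close> sums over \<open>Y\<close> alone, testing whether the translate by
  \<open>d\<close> falls into \<open>X\<close>.\<close>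

lemma count_diff_mset:
  fixes G (structure)
  assumes G: "group G" and X: "X \<subseteq> carrier G" "finite X" and Y: "Y \<subseteq> carrier G" "finite Y"
    and d: "d \<in> carrier G"
  shows "count (diff_mset G (mset_set X) (repeat_mset w (mset_set Y))) d = w * diff_count G d X Y"
proof -
  interpret group G by (rule G)
  have eq: "x \<otimes> inv y = d \<longleftrightarrow> x = d \<otimes> y" if "x \<in> X" "y \<in> Y" for x y
    using that X Y d by (metis inv_solve_right subsetD)
  have "count (diff_mset G (mset_set X) (repeat_mset w (mset_set Y))) d =
      (\<Sum>x\<in>X. w * (\<Sum>y\<in>Y. of_bool (x \<otimes> inv y = d)))"
    using Y by (simp add: diff_mset_def sum_unfold_sum_mset [symmetric] count_sum
        count_image_repeat_mset count_image_mset_set)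
  also have "\<dots> = w * (\<Sum>y\<in>Y. \<Sum>x\<in>X. of_bool (x \<otimes> inv y = d))"
    by (simp only: sum_distrib_left [symmetric]) (subst sum.swap, rule refl)
  also have "(\<Sum>y\<in>Y. \<Sum>x\<in>X. of_bool (x \<otimes> inv y = d)) = diff_count G d X Y"
    unfolding diff_count_def
  proof (rule sum.cong [OF refl])
    fix y assume y: "y \<in> Y"
    have "(\<Sum>x\<in>X. of_bool (x \<otimes> inv y = d)) = (\<Sum>x\<in>X. of_bool (x = d \<otimes> y) :: nat)"
      using eq y by (intro sum.cong) auto
    also have "\<dots> = of_bool (d \<otimes> y \<in> X)"
      using X by (simp add: of_bool_def)
    finally show "(\<Sum>x\<in>X. of_bool (x \<otimes> inv y = d)) = (of_bool (d \<otimes> y \<in> X) :: nat)" .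
  qed
  finally show ?thesis .
qed

text \<open>Pairs with \<open>x = y\<close> produce only the identity. For
  \<open>d \<noteq> \<one>\<close> the diagonal may therefore be added, which turns the multiset in
  the PDF condition into the full product count.\<close>

lemma count_internal_differences:
  fixes G (structure)
  assumes G: "group G" and B: "B \<subseteq> carrier G" "finite B" and d: "d \<in> carrier G" "d \<noteq> \<one>"
  shows "count (image_mset (\<lambda>(x, y). x \<otimes> inv y)
           (mset_set {(x, y). x \<in> B \<and> y \<in> B \<and> x \<noteq> y})) d = diff_count G d B B"
proof -
  interpret group G by (rule G)
  let ?P = "{(x, y). x \<in> B \<and> y \<in> B \<and> x \<noteq> y}"
  have fin: "finite ?P"
    by (rule finite_subset [of _ "B \<times> B"]) (use B in auto)
  have "count (image_mset (\<lambda>(x, y). x \<otimes> inv y) (mset_set ?P)) d =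
      (\<Sum>(x, y)\<in>?P. of_bool (x \<otimes> inv y = d))"
    using fin by (simp add: count_image_mset_set case_prod_beta)
  also have "\<dots> = (\<Sum>(x, y)\<in>B \<times> B. of_bool (x \<otimes> inv y = d))"
    by (rule sum.mono_neutral_left) (use B d in auto)
  also have "\<dots> = count (diff_mset G (mset_set B) (repeat_mset 1 (mset_set B))) d"
    using B by (simp add: diff_mset_def sum_unfold_sum_mset [symmetric] count_sum
        count_image_mset_set sum.cartesian_product del: sum_of_bool_eq)
  finally show ?thesis
    using count_diff_mset [OF G B B d(1), of 1] by simp
qed

lemma diff_count_singleton:
  fixes G (structure)
  assumes G: "group G" and "v \<in> carrier G" "d \<in> carrier G" "d \<noteq> \<one>"
  shows "diff_count G d {v} {v} = 0"
  using assms by (simp add: diff_count_def group.r_cancel_one)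

text \<open>Translation by \<open>d\<close> maps a subgroup onto itself when \<open>d\<close>
  belongs to it, and onto a disjoint coset otherwise.\<close>

lemma diff_count_subgroup:
  fixes G (structure)
  assumes G: "group G" and H: "subgroup H G" and d: "d \<in> carrier G"
  shows "diff_count G d H H = (if d \<in> H then card H else 0)"
proof -
  interpret group G by (rule G)
  have "d \<otimes> y \<in> H \<longleftrightarrow> d \<in> H" if y: "y \<in> H" for y
  proof
    assume "d \<otimes> y \<in> H"
    then have "(d \<otimes> y) \<otimes> inv y \<in> H"
      using H y by (simp add: subgroup.m_closed subgroup.m_inv_closed)
    then show "d \<in> H"
      using d subgroup.mem_carrier [OF H y] by (simp add: m_assoc)
  qed (use H y in \<open>simp add: subgroup.m_closed\<close>)
  then show ?thesis
    by (simp add: diff_count_def)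
qed

section \<open>External differences of a partition of the non-identity elements\<close>

text \<open>For \<open>y \<in> V j\<close>, the element \<open>d \<otimes> y\<close> is \<open>\<one>\<close>, or in \<open>V j\<close>, or in exactly one other block.\<close>

lemma external_diff_count:
  fixes G (structure)
  assumes G: "group G" and fin: "finite (carrier G)" "finite I"
    and V: "disjoint_family_on V I" "(\<Union>i\<in>I. V i) = carrier G - {\<one>}"
    and d: "d \<in> carrier G"
  shows "(\<Sum>(i, j)\<in>{(i, j). i \<in> I \<and> j \<in> I \<and> i \<noteq> j}. w j * diff_count G d (V i) (V j))
      + (\<Sum>j\<in>I. w j * diff_count G d (V j) (V j))
      + (\<Sum>j\<in>I. w j * of_bool (inv d \<in> V j))
      = (\<Sum>j\<in>I. w j * card (V j))"
proof -
  interpret group G by (rule G)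
  let ?c = "\<lambda>i j. w j * diff_count G d (V i) (V j)"
  let ?N = "{(i, j). i \<in> I \<and> j \<in> I \<and> i \<noteq> j}"
  have finV: "finite (V j)" if "j \<in> I" for j
    using V(2) fin that by (metis SUP_upper finite_Diff finite_subset)
  have Vc: "V j \<subseteq> carrier G" if "j \<in> I" for j
    using V(2) that by blast
  have block: "(\<Sum>i\<in>I. diff_count G d (V i) (V j)) + of_bool (inv d \<in> V j) = card (V j)"
    if j: "j \<in> I" for j
  proof -
    have pt: "(\<Sum>i\<in>I. of_bool (d \<otimes> y \<in> V i)) + of_bool (y = inv d) = (1 :: nat)"
      if y: "y \<in> V j" for y
    proof (cases "d \<otimes> y = \<one>")
      case True
      then have "y = inv d"
        using y d Vc [OF j] by (metis inv_equality inv_inv subsetD)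
      moreover have "d \<otimes> y \<notin> V i" if "i \<in> I" for i
        using that True V(2) by blast
      ultimately show ?thesis by simp
    next
      case False
      then have ne: "y \<noteq> inv d"
        using d by auto
      have "d \<otimes> y \<in> (\<Union>i\<in>I. V i)"
        using False V(2) d y Vc [OF j] by auto
      then obtain i0 where i0: "i0 \<in> I" "d \<otimes> y \<in> V i0" by blast
      then have "d \<otimes> y \<in> V i \<longleftrightarrow> i = i0" if "i \<in> I" for i
        using V(1) that by (auto simp: disjoint_family_on_def)
      then have "(\<Sum>i\<in>I. of_bool (d \<otimes> y \<in> V i)) = (\<Sum>i\<in>I. of_bool (i = i0) :: nat)"
        by (intro sum.cong) auto
      also have "\<dots> = 1"
        using fin i0 by (simp add: of_bool_def)
      finally show ?thesis
        using ne by simp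
    qed
    have "(\<Sum>i\<in>I. diff_count G d (V i) (V j)) + of_bool (inv d \<in> V j)
        = (\<Sum>y\<in>V j. \<Sum>i\<in>I. of_bool (d \<otimes> y \<in> V i)) + (\<Sum>y\<in>V j. of_bool (y = inv d))"
      unfolding diff_count_def using finV [OF j] by (subst sum.swap) (simp add: of_bool_def)
    also have "\<dots> = (\<Sum>y\<in>V j. 1)"
      unfolding sum.distrib [symmetric] using pt by (intro sum.cong) auto
    finally show ?thesis by simp
  qed
  \<comment> \<open>Adding the diagonal completes the index set to the square
    \<open>I \<times> I\<close>. The sum can then be grouped by \<open>j\<close>, where the weight
    is constant, and \<open>block\<close> applies to each group.\<close>
  have "(\<Sum>(i, j)\<in>?N. ?c i j) + (\<Sum>j\<in>I. ?c j j) =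
      (\<Sum>(i, j)\<in>?N. ?c i j) + (\<Sum>(i, j)\<in>(\<lambda>j. (j, j)) ` I. ?c i j)"
    by (simp add: sum.reindex inj_on_def)
  also have "\<dots> = (\<Sum>(i, j)\<in>?N \<union> (\<lambda>j. (j, j)) ` I. ?c i j)"
    by (rule sum.union_disjoint [symmetric])
      (use fin in \<open>auto intro: finite_subset [of _ "I \<times> I"]\<close>)
  also have "?N \<union> (\<lambda>j. (j, j)) ` I = I \<times> I"
    by auto
  also have "(\<Sum>(i, j)\<in>I \<times> I. ?c i j) = (\<Sum>j\<in>I. w j * (\<Sum>i\<in>I. diff_count G d (V i) (V j)))"
    by (simp add: sum.cartesian_product [symmetric] sum_distrib_left) (rule sum.swap)
  finally show ?thesis
    using block by (simp add: sum.distrib [symmetric] distrib_left [symmetric])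
qed

section \<open>The construction in a finite commutative group\<close>

lemma sum_list_block_sizes:
  "sum_list (block_sizes m B) = (\<Sum>i\<in>{1..m}. card (B i))"
  unfolding block_sizes_def
  by (simp only: sum_set_upt_conv_sum_list_nat [symmetric] set_upt atLeastLessThanSuc_atLeastAtMost)

lemma block_sizes_nth:
  assumes "i \<in> {1..m}"
  shows "block_sizes m B ! (i - 1) = card (B i)"
  using assms by (cases i) (simp_all add: block_sizes_def del: upt_Suc)

text \<open>The count rests on the last block being a subgroup of size \<open>k - 1\<close>, so the
  product structure of the group is kept out of this argument. The map \<open>h\<close> enumerates
  the elements that become singletons, and \<open>large\<close> makes the multiplicity
  positive.\<close>

theorem SWEDF_of_PDF_subgroup:
  fixes G (structure) and k s :: nat and h :: "nat \<Rightarrow> 'a"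
  assumes k: "k \<ge> 2" and s: "s \<ge> 1" and large: "s + k \<ge> 4"
    and pdf: "PDF G n (Suc s) (replicate s k @ [k - 1]) (k - 1) R"
    and sub: "subgroup (R (Suc s)) G"
    and h: "bij_betw h {1..k - 2} (R (Suc s) - {\<one>})"
    and V_R: "\<And>i. i \<in> {1..s} \<Longrightarrow> V i = R i"
    and V_h: "\<And>j. j \<in> {1..k - 2} \<Longrightarrow> V (s + j) = {h j}"
  shows "SWEDF G n (s + k - 2) (replicate s k @ replicate (k - 2) 1) (n - 1) (k * (s + k - 3)) V"
proof -
  define H where "H = R (Suc s)"
  define m where "m = s + k - 2"
  interpret comm_group G
    using pdf by (simp add: PDF_def)
  have fin: "finite (carrier G)" and ord: "order G = n"
    and disjR: "disjoint_family_on R {1..Suc s}"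
    and sizes: "block_sizes (Suc s) R = replicate s k @ [k - 1]"
    using pdf by (auto simp: PDF_def)
  have unR: "(\<Union>i\<in>{1..Suc s}. R i) = carrier G"
    using pdf by (simp add: PDF_def partition_on_def)
  have cR: "card (R i) = k" if "i \<in> {1..s}" for i
  proof -
    have "card (R i) = (replicate s k @ [k - 1]) ! (i - 1)"
      using block_sizes_nth [of i "Suc s" R] that by (simp add: sizes)
    also have "\<dots> = k"
      using that by (auto simp: nth_append)
    finally show ?thesis .
  qed
  have cH: "card H = k - 1"
    using block_sizes_nth [of "Suc s" "Suc s" R] unfolding sizes H_def by (auto simp: nth_append)
  have oneH: "\<one> \<in> H"
    using sub by (simp add: H_def subgroup.one_closed)
  have RH: "R i \<inter> H = {}" if "i \<in> {1..s}" for i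
    using disjR that unfolding H_def by (auto simp: disjoint_family_on_def)
  have m_eq: "m = s + (k - 2)"
    using k by (simp add: m_def)
  have split: "{1..m} = {1..s} \<union> (+) s ` {1..k - 2}"
    unfolding m_eq by (auto simp: image_iff Bex_def)
  have hH: "h j \<in> H - {\<one>}" if "j \<in> {1..k - 2}" for j
    using h that unfolding H_def by (rule bij_betwE [THEN bspec])
  have V_cases: "(i \<in> {1..s} \<and> V i = R i) \<or>
      (\<exists>j\<in>{1..k - 2}. i = s + j \<and> V i = {h j})" if "i \<in> {1..m}" for i
  proof -
    have "i \<in> {1..s} \<or> i \<in> (+) s ` {1..k - 2}"
      using that unfolding split by (rule UnE) blast+
    then show ?thesis
      using V_R V_h by blast
  qed
  have disjV: "disjoint_family_on V {1..m}"
    unfolding disjoint_family_on_def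
  proof (intro ballI impI)
    fix i j assume ij: "i \<in> {1..m}" "j \<in> {1..m}" "i \<noteq> j"
    have disjRR: "R i \<inter> R j = {}" if "i \<in> {1..s}" "j \<in> {1..s}"
      using disjR ij that by (auto simp: disjoint_family_on_def)
    have notRh: "h b \<notin> R a" if "a \<in> {1..s}" "b \<in> {1..k - 2}" for a b
      using RH [OF that(1)] hH [OF that(2)] by blast
    have h_ne: "h a \<noteq> h b" if "a \<in> {1..k - 2}" "b \<in> {1..k - 2}" "a \<noteq> b" for a b
      using bij_betw_imp_inj_on [OF h] that by (meson inj_onD)
    consider (RR) "i \<in> {1..s}" "V i = R i" "j \<in> {1..s}" "V j = R j"
      | (Rh) b where "i \<in> {1..s}" "V i = R i" "b \<in> {1..k - 2}" "V j = {h b}"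
      | (hR) a where "a \<in> {1..k - 2}" "V i = {h a}" "j \<in> {1..s}" "V j = R j"
      | (hh) a b where "a \<in> {1..k - 2}" "b \<in> {1..k - 2}" "i = s + a" "j = s + b"
          "V i = {h a}" "V j = {h b}"
      using V_cases [OF ij(1)] V_cases [OF ij(2)] by metis
    then show "V i \<inter> V j = {}"
    proof cases
      case RR
      then show ?thesis using disjRR by simp
    next
      case (Rh b)
      then show ?thesis using notRh [of i b] by simp
    next
      case (hR a)
      then show ?thesis using notRh [of j a] by simp
    next
      case (hh a b)
      then show ?thesis using h_ne [of a b] ij(3) by simp
    qed
  qed
  have unV: "(\<Union>i\<in>{1..m}. V i) = carrier G - {\<one>}"
  proof -
    have "(\<Union>i\<in>{1..m}. V i) = (\<Union>i\<in>{1..s}. V i) \<union> (\<Union>j\<in>{1..k - 2}. V (s + j))"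
      unfolding split by (simp only: UN_Un image_image)
    also have "\<dots> = (\<Union>i\<in>{1..s}. R i) \<union> h ` {1..k - 2}"
      using V_R V_h by auto
    also have "h ` {1..k - 2} = H - {\<one>}"
      using h by (simp add: bij_betw_def H_def)
    \<comment> \<open>The other blocks are disjoint from \<open>H\<close>, which contains the
      identity, so removing it from \<open>H\<close> removes it from the whole union.\<close>
    also have "(\<Union>i\<in>{1..s}. R i) \<union> (H - {\<one>}) = ((\<Union>i\<in>{1..s}. R i) \<union> H) - {\<one>}"
      using RH oneH by blast
    also have "(\<Union>i\<in>{1..s}. R i) \<union> H = carrier G"
      using unR by (simp add: H_def atLeastAtMostSuc_conv Un_commute)
    finally show ?thesis .
  qed
  have Vc: "V i \<subseteq> carrier G" if "i \<in> {1..m}" for i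
    using unV that by blast
  have Vfin: "finite (V i)" if "i \<in> {1..m}" for i
    using Vc [OF that] fin finite_subset by blast
  have Vne: "V i \<noteq> {}" if "i \<in> {1..m}" for i
    using V_cases [OF that] cR [of i] k by auto
  have sizesV: "block_sizes m V = replicate s k @ replicate (k - 2) 1"
  proof (rule nth_equalityI)
    show "length (block_sizes m V) = length (replicate s k @ replicate (k - 2) 1)"
      by (simp add: block_sizes_def m_eq del: upt_Suc)
    fix i assume "i < length (block_sizes m V)"
    then have i: "Suc i \<in> {1..m}"
      by (simp add: block_sizes_def del: upt_Suc)
    then show "block_sizes m V ! i = (replicate s k @ replicate (k - 2) 1) ! i"
      using block_sizes_nth [OF i, of V] V_cases [OF i] cR [of "Suc i"] m_eq
      by (auto simp: nth_append)
  qed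
  \<comment> \<open>The total comes from the partition itself: \<open>n\<close> is tied to
    \<open>k\<close> and \<open>s\<close> only through the PDF.\<close>
  have total: "sum_list (replicate s k @ replicate (k - 2) 1) = n - 1"
  proof -
    have "(\<Sum>i\<in>{1..m}. card (V i)) = card (\<Union>i\<in>{1..m}. V i)"
      using disjV Vfin
      by (intro card_UN_disjoint [symmetric]) (auto simp: disjoint_family_on_def)
    also have "\<dots> = n - 1"
      unfolding unV using fin ord by (simp add: order_def)
    finally show ?thesis
      unfolding sizesV [symmetric] sum_list_block_sizes .
  qed
  define w where "w i = Lcm ((\<lambda>j. card (V j)) ` {1..m}) div card (V i)" for i
  have lcm: "Lcm ((\<lambda>j. card (V j)) ` {1..m}) = k"
  proof (rule dvd_antisym)
    show "Lcm ((\<lambda>j. card (V j)) ` {1..m}) dvd k"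
      using V_cases cR by (intro Lcm_least) fastforce
    \<comment> \<open>As \<open>s \<ge> 1\<close>, a block of size \<open>k\<close> does occur;
      without one the least common multiple would be 1.\<close>
    have "k = card (V 1)" "1 \<in> {1..m}"
      using s cR [of 1] V_R [of 1] by (auto simp: m_eq)
    then show "k dvd Lcm ((\<lambda>j. card (V j)) ` {1..m})"
      by (intro dvd_Lcm) auto
  qed
  then have w_eq: "w i = k div card (V i)" for i
    by (simp only: w_def)
  have w_R: "w i = 1" if "i \<in> {1..s}" for i
    using that V_R cR k by (simp add: w_eq)
  have w_h: "w (s + j) = k" if "j \<in> {1..k - 2}" for j
    using that V_h by (simp add: w_eq)
  \<comment> \<open>The weights 1 and \<open>k\<close> equalize the blocks, so the leading term of
    the count is \<open>k * m\<close> whatever the mix of sizes.\<close>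
  have w_card: "w i * card (V i) = k" if "i \<in> {1..m}" for i
    using V_cases [OF that] w_R [of i] w_h cR [of i] by auto
  have sum_split: "(\<Sum>i\<in>{1..m}. f i) = (\<Sum>i\<in>{1..s}. f i) + (\<Sum>j\<in>{1..k - 2}. f (s + j))"
    for f :: "nat \<Rightarrow> nat"
    unfolding split by (subst sum.union_disjoint; (subst sum.reindex)?) auto
  let ?E = "\<lambda>d. \<Sum>(i, j)\<in>{(i, j). i \<in> {1..m} \<and> j \<in> {1..m} \<and> i \<noteq> j}.
      w j * diff_count G d (V i) (V j)"
  have E: "?E d = (if d = \<one> then 0 else k * (s + k - 3))" if d: "d \<in> carrier G" for d
  proof (cases "d = \<one>")
    case True
    \<comment> \<open>Distinct blocks share no element, hence the identity is never an external
      difference.\<close>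
    have "diff_count G d (V i) (V j) = 0" if "i \<in> {1..m}" "j \<in> {1..m}" "i \<noteq> j" for i j
    proof -
      have "V i \<inter> V j = {}"
        using disjoint_family_onD [OF disjV that] .
      moreover have "d \<otimes> y = y" if "y \<in> V j" for y
        using True Vc [OF \<open>j \<in> {1..m}\<close>] that by auto
      ultimately have "d \<otimes> y \<notin> V i" if "y \<in> V j" for y
        using that by auto
      then show ?thesis
        by (simp add: diff_count_def)
    qed
    then show ?thesis
      using True by (auto intro!: sum.neutral)
  next
    case False
    \<comment> \<open>Splitting off the last block isolates the internal differences that survive in
      \<open>V\<close>.\<close>
    have internal_R: "(\<Sum>i\<in>{1..s}. diff_count G d (R i) (R i)) + diff_count G d H H = k - 1"
    proof -
      have Rc: "R i \<subseteq> carrier G" if "i \<in> {1..Suc s}" for i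
        using unR that by blast
      have "(\<Sum>i\<in>{1..Suc s}. diff_count G d (R i) (R i)) =
          count (\<Sum>i = 1..Suc s. image_mset (\<lambda>(x, y). x \<otimes> inv y)
            (mset_set {(x, y). x \<in> R i \<and> y \<in> R i \<and> x \<noteq> y})) d"
        unfolding count_sum
        by (rule sum.cong [OF refl], rule count_internal_differences [OF is_group, symmetric])
          (use Rc fin finite_subset d False in metis)+
      also have "count (\<Sum>i = 1..Suc s. image_mset (\<lambda>(x, y). x \<otimes> inv y)
          (mset_set {(x, y). x \<in> R i \<and> y \<in> R i \<and> x \<noteq> y})) d = k - 1"
        using pdf d False unfolding PDF_def by (elim conjE) (drule bspec [of _ _ d], simp_all only: Diff_iff singleton_iff simp_thms)
      finally show ?thesis
        by (simp add: H_def)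
    qed
    have "(\<Sum>j\<in>{1..m}. w j * diff_count G d (V j) (V j)) =
        (\<Sum>i\<in>{1..s}. diff_count G d (R i) (R i))"
    proof -
      have "w j * diff_count G d (V j) (V j) = diff_count G d (R j) (R j)" if "j \<in> {1..s}" for j
        using w_R V_R that by simp
      \<comment> \<open>The weight \<open>k\<close> of a singleton has no effect here, as its only
        internal difference is the identity.\<close>
      moreover have "diff_count G d (V (s + j)) (V (s + j)) = 0" if "j \<in> {1..k - 2}" for j
        using V_h [OF that] hH [OF that] sub d False
        by (simp add: H_def diff_count_singleton [OF is_group] subgroup.mem_carrier)
      ultimately show ?thesis
        unfolding sum_split by simp
    qed
    then have internal: "(\<Sum>j\<in>{1..m}. w j * diff_count G d (V j) (V j))
        + (if d \<in> H then k - 1 else 0) = k - 1"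
      using internal_R diff_count_subgroup [OF is_group sub d, folded H_def] cH by (simp only:)
    have "inv d \<in> (\<Union>i\<in>{1..m}. V i)"
      unfolding unV using d False by simp
    then obtain i0 where i0: "i0 \<in> {1..m}" "inv d \<in> V i0"
      by blast
    have inv_H: "inv d \<in> H \<longleftrightarrow> d \<in> H"
      using sub d unfolding H_def by (metis inv_inv subgroup.m_inv_closed)
    \<comment> \<open>The block containing \<open>inv d\<close> is a singleton exactly when
      \<open>inv d\<close>, equivalently \<open>d\<close>, lies in \<open>H\<close>.\<close>
    have w_i0: "w i0 = (if d \<in> H then k else 1)"
      using V_cases [OF i0(1)]
    proof (elim disjE bexE conjE)
      assume "i0 \<in> {1..s}" "V i0 = R i0"
      then have "inv d \<notin> H"
        using RH [of i0] i0(2) by blast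
      then show ?thesis
        using inv_H w_R [OF \<open>i0 \<in> {1..s}\<close>] by simp
    next
      fix j assume "j \<in> {1..k - 2}" "i0 = s + j" "V i0 = {h j}"
      then show ?thesis
        using inv_H w_h [of j] hH [of j] i0(2) by simp
    qed
    have "inv d \<in> V j \<longleftrightarrow> j = i0" if "j \<in> {1..m}" for j
      using disjoint_family_onD [OF disjV i0(1) that] i0(2) by blast
    then have "(\<Sum>j\<in>{1..m}. w j * of_bool (inv d \<in> V j)) = (\<Sum>j\<in>{1..m}. w j * of_bool (j = i0))"
      by (intro sum.cong) auto
    also have "\<dots> = w i0"
      using i0 by (simp add: of_bool_def if_distrib cong: if_cong)
    finally have hit: "(\<Sum>j\<in>{1..m}. w j * of_bool (inv d \<in> V j)) = (if d \<in> H then k else 1)"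
      using w_i0 by simp
    have "(\<Sum>j\<in>{1..m}. w j * card (V j)) = k * m"
      using w_card by simp
    then have total_count: "?E d + (\<Sum>j\<in>{1..m}. w j * diff_count G d (V j) (V j))
        + (\<Sum>j\<in>{1..m}. w j * of_bool (inv d \<in> V j)) = k * m"
      using external_diff_count [OF is_group fin _ disjV unV d, of w] by simp
    \<comment> \<open>The two corrections \<open>u\<close> and \<open>v\<close> are 0 and
      \<open>k\<close> under \<open>P\<close>, and \<open>k - 1\<close> and 1 otherwise, so they
      always add up to \<open>k\<close>.\<close>
    have arith: "e + k = c" if "e + u + v = c" "u + (if P then k - 1 else 0) = k - 1"
      "v = (if P then k else 1)" for e u v c :: nat and P
      using that k by (auto split: if_splits)
    have "?E d + k = k * m"
      by (rule arith [OF total_count internal hit])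
    then have "?E d = k * (m - 1)"
      by (simp add: diff_mult_distrib2)
    then show ?thesis
      using False k by (simp add: m_def)
  qed
  have "(\<Sum>(i, j)\<in>{(i, j). i \<in> {1..m} \<and> j \<in> {1..m} \<and> i \<noteq> j}.
        diff_mset G (mset_set (V i)) (weighted_block m V j))
      = repeat_mset (k * (s + k - 3)) (mset_set (carrier G - {\<one>}))" (is "?M = ?N")
  proof (rule multiset_eqI)
    fix d
    show "count ?M d = count ?N d"
    proof (cases "d \<in> carrier G")
      case True
      have "count ?M d = ?E d"
        unfolding count_sum weighted_block_def w_def [symmetric]
        by (intro sum.cong) (auto simp: count_sum count_diff_mset [OF is_group] Vc Vfin True)
      then show ?thesis
        using E [OF True] fin True by (simp add: count_mset_set')
    next
      case False
      \<comment> \<open>Equality of multisets also concerns elements of the type outside the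
        carrier; differences of group elements never reach them.\<close>
      have "d \<notin># diff_mset G (mset_set (V i)) (weighted_block m V j)"
        if "i \<in> {1..m}" "j \<in> {1..m}" for i j
        using Vc [OF that(1)] Vc [OF that(2)] Vfin [OF that(1)] Vfin [OF that(2)] False
        by (auto simp: diff_mset_def weighted_block_def subset_iff dest!: in_repeat_msetD)
      then have "count ?M d = 0"
        unfolding count_sum by (auto simp: not_in_iff intro!: sum.neutral)
      then show ?thesis
        using fin False by (simp add: count_mset_set')
    qed
  qed
  moreover have "0 < k * (s + k - 3)"
    using k large by simp
  ultimately show ?thesis
    unfolding SWEDF_def m_def [symmetric]
    using comm_group_axioms fin ord Vne Vc disjV sizesV total
    by (intro conjI ballI) (assumption | rule Vne Vc, assumption)+
qed

section \<open>Cyclicity and specialization to the integers modulo \<open>n\<close>\<close>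

lemma cyclic_integer_mod_group: "cyclic_group (integer_mod_group n)"
proof (cases "n = 0")
  case False
  have "x \<in> range (\<lambda>y. y mod int n)" if "x \<in> {0..<int n}" for x
    using that by (intro range_eqI [of _ _ x]) simp
  \<comment> \<open>Reduction modulo \<open>n\<close> is onto, and an epimorphic image of the cyclic
    group of integers is cyclic.\<close>
  then have "(\<lambda>x. x mod int n) \<in> epi integer_group (integer_mod_group n)"
    using False
    by (auto simp: epi_def hom_def integer_group_def carrier_integer_mod_group mod_add_eq)
  then show ?thesis
    by (rule group.cyclic_group_epimorphic_image [OF group_integer_group]) simp_all
\<comment> \<open>For \<open>n = 0\<close> the group is by definition that of all integers.\<close>
qed (use cyclic_integer_group in \<open>simp add: integer_mod_group_def\<close>)

theorem theorem6:
  fixes k t n l :: nat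
    and \<phi> :: "int \<Rightarrow> int \<times> int"
    and R V :: "nat \<Rightarrow> int set"
  assumes k: "k \<ge> 2" and t: "t \<ge> 1"
    and gcd: "gcd (k - 1) (t * k + 1) = 1"
    and n: "n = (k - 1) * (t * k + 1)"
    and l: "l = t * (k - 1) + 1"
    and ident: "\<phi> \<in> iso (integer_mod_group n)
                     (integer_mod_group (k - 1) \<times>\<times> integer_mod_group (t * k + 1))"
    and m: "t * (k - 1) + k - 2 \<ge> 2"
    and R_PDF: "PDF (integer_mod_group n) n l (replicate (l - 1) k @ [k - 1]) (k - 1) R"
    and R_card: "\<And>i. i \<in> {1..l - 1} \<Longrightarrow> card (R i) = k"
    and R_last: "R l = inv_into (carrier (integer_mod_group n)) \<phi> `
                         (carrier (integer_mod_group (k - 1)) \<times> {0})"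
    and V_R: "\<And>i. i \<in> {1..t * (k - 1)} \<Longrightarrow> V i = R i"
    and V_single: "\<And>j. j \<in> {1..k - 2} \<Longrightarrow>
                     V (t * (k - 1) + j) = {inv_into (carrier (integer_mod_group n)) \<phi> (int j, 0)}"
  shows "cyclic_SWEDF (integer_mod_group n) n (t * (k - 1) + k - 2)
           (replicate (t * (k - 1)) k @ replicate (k - 2) 1)
           (n - 1) ((t + 1) * k ^ 2 - (t + 3) * k) V"
proof -
  let ?G = "integer_mod_group n" and ?A = "integer_mod_group (k - 1)"
    and ?B = "integer_mod_group (t * k + 1)"
  let ?\<psi> = "inv_into (carrier ?G) \<phi>"
  define s where "s = t * (k - 1)"
  have l_eq: "l = Suc s"
    by (simp add: l s_def)
  have iso: "?\<psi> \<in> iso (?A \<times>\<times> ?B) ?G"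
    using ident by (simp add: group.iso_set_sym)
  interpret \<psi>: group_hom "?A \<times>\<times> ?B" ?G ?\<psi>
    using iso by (simp add: group_hom_def group_hom_axioms_def DirProd_group iso_imp_homomorphism)
  have sub: "subgroup (R l) ?G"
  proof -
    \<comment> \<open>The last block is the image of this product subgroup under the inverse
      identification, which is a homomorphism.\<close>
    have "subgroup (carrier ?A \<times> {\<one>\<^bsub>?B\<^esub>}) (?A \<times>\<times> ?B)"
      by (intro DirProd_subgroups group.subgroup_self group.triv_subgroup) simp_all
    then have "subgroup (?\<psi> ` (carrier ?A \<times> {0})) ?G"
      using \<psi>.subgroup_img_is_subgroup by simp
    then show ?thesis
      by (simp add: R_last)
  qed
  have bij: "bij_betw (\<lambda>j. ?\<psi> (int j, 0)) {1..k - 2} (R l - {\<one>\<^bsub>?G\<^esub>})"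
  proof -
    \<comment> \<open>Here \<open>k \<ge> 2\<close> matters: modulus 0 would give all integers
      instead of a range of residues.\<close>
    have cA: "carrier ?A = {0..<int (k - 1)}"
      using k by (simp add: carrier_integer_mod_group)
    have inj: "inj_on ?\<psi> (carrier ?A \<times> carrier ?B)"
      using iso by (simp add: iso_def bij_betw_def)
    have zeroB: "0 \<in> carrier ?B"
      by simp
    have one: "?\<psi> (0, 0) = \<one>\<^bsub>?G\<^esub>"
      using \<psi>.hom_one by simp
    \<comment> \<open>The nonzero residues modulo \<open>k - 1\<close> are 1 up to
      \<open>k - 2\<close>; for \<open>k = 2\<close> both sides are empty.\<close>
    have img: "(\<lambda>j. (int j, 0 :: int)) ` {1..k - 2} = carrier ?A \<times> {0} - {(0, 0)}"
    proof -
      have "(\<lambda>j. (int j, 0 :: int)) ` {1..k - 2} = int ` {1..k - 2} \<times> {0}"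
        by auto
      also have "int ` {1..k - 2} = {0..<int (k - 1)} - {0}"
        unfolding image_int_atLeastAtMost using k by auto
      also have "\<dots> \<times> {0} = carrier ?A \<times> {0} - {(0, 0)}"
        unfolding cA by auto
      finally show ?thesis .
    qed
    have "?\<psi> ` (\<lambda>j. (int j, 0)) ` {1..k - 2} = R l - {\<one>\<^bsub>?G\<^esub>}"
      unfolding img R_last one [symmetric]
      by (subst inj_on_image_set_diff [OF inj]) (use zeroB cA k in auto)
    moreover have "inj_on ?\<psi> ((\<lambda>j. (int j, 0)) ` {1..k - 2})"
      unfolding img by (rule inj_on_subset [OF inj]) (use zeroB in auto)
    ultimately show ?thesis
      by (auto simp: bij_betw_def inj_on_def image_image)
  qed
  have "SWEDF ?G n (s + k - 2) (replicate s k @ replicate (k - 2) 1) (n - 1) (k * (s + k - 3)) V"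
  proof (rule SWEDF_of_PDF_subgroup)
    show "s \<ge> 1"
      using k t by (simp add: s_def)
    show "s + k \<ge> 4"
      using m by (simp add: s_def)
    show "PDF ?G n (Suc s) (replicate s k @ [k - 1]) (k - 1) R"
      using R_PDF by (simp add: l_eq)
  qed (use k sub bij V_R V_single in \<open>auto simp: l_eq s_def\<close>)
  moreover have "k * (s + k - 3) = (t + 1) * k ^ 2 - (t + 3) * k"
  proof -
    \<comment> \<open>Writing \<open>k\<close> as a successor removes the truncated
      \<open>k - 1\<close> inside \<open>s\<close>. The extra \<open>t * k\<close> in the identity
      below cancels against part of \<open>(t + 3) * k\<close>, leaving \<open>3 * k\<close> to
      subtract.\<close>
    obtain c where c: "k = Suc c"
      using k by (cases k) auto
    have "(t + 1) * k ^ 2 = k * (s + k) + t * k"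
      by (simp add: s_def c power2_eq_square algebra_simps)
    then show ?thesis
      by (simp add: diff_mult_distrib2 algebra_simps)
  qed
  moreover have "cyclic_group ?G"
    by (simp add: cyclic_integer_mod_group)
  ultimately show ?thesis
    by (simp add: cyclic_SWEDF_def s_def)
qed

end
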